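(* If $\mathfrak p=\mathfrak d$, then there exists a Q-ultrafilter on $\omega$ which is not Halpern--Läuchli.
   Context: $\mathfrak p$ is the minimal size of a filter base $\mathcal B\subseteq[\omega]^\omega$ with no infinite pseudo-intersection ($P$ with $P\setminus B$ finite for all $B\in\mathcal B$). $\mathfrak d$ is the minimal size of a family $\mathcal D\subseteq\omega^\omega$ such that every $f\in\omega^\omega$ is dominated everywhere by some $g\in\mathcal D$. A Q-ultrafilter is a nonprincipal ultrafilter $\mathcal U$ such that for every partition of $\omega$ into finite intervals there is $U\in\mathcal U$ meeting each interval in at most one point. A tree is an initial subset of $(2^{<\omega},\subseteq)$ without maximal elements, perfect if every node has two incompatible extensions in it; $\mathbf S$ is the set of perfect trees; $p\restriction A=\{s\in p\cap2^n:n\in A\}$. An ultrafilter $\mathcal U$ is Halpern--Läuchli if for every $c:2^{<\omega}\to2$ there are $p\in\mathbf S$ and $A\in\mathcal U$ with $c$ constant on $p\restriction A$. *)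

theory Defs
  imports Main "HOL-Library.Sublist" "HOL-Library.Disjoint_Sets" "HOL-Library.Nat_Bijection"
begin

unbundle cardinal_syntax

text \<open>Cardinals are cardinal orders, compared by \<open>\<le>o\<close> and \<open>=o\<close>. The minimum over a nonempty
  collection exists and is unique up to \<open>=o\<close>; nonemptiness for the two uses is shown below.\<close>

definition min_card :: "'a set set \<Rightarrow> 'a rel" where
  "min_card \<F> = (SOME r. (\<exists>X\<in>\<F>. r = |X| ) \<and> (\<forall>X\<in>\<F>. r \<le>o |X| ))"

definition filter_base :: "nat set set \<Rightarrow> bool" where
  "filter_base \<B> \<longleftrightarrow> \<B> \<noteq> {} \<and> (\<forall>A\<in>\<B>. infinite A) \<and> (\<forall>A\<in>\<B>. \<forall>B\<in>\<B>. \<exists>C\<in>\<B>. C \<subseteq> A \<inter> B)"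

definition pseudo_intersection :: "nat set \<Rightarrow> nat set set \<Rightarrow> bool" where
  "pseudo_intersection P \<B> \<longleftrightarrow> (\<forall>B\<in>\<B>. finite (P - B))"

definition cardinal_p :: "nat set rel" where
  "cardinal_p = min_card {\<B>. filter_base \<B> \<and> \<not> (\<exists>P. infinite P \<and> pseudo_intersection P \<B>)}"

definition dominating :: "(nat \<Rightarrow> nat) set \<Rightarrow> bool" where
  "dominating \<D> \<longleftrightarrow> (\<forall>f. \<exists>g\<in>\<D>. \<forall>n. f n \<le> g n)"

definition cardinal_d :: "(nat \<Rightarrow> nat) rel" where
  "cardinal_d = min_card {\<D>. dominating \<D>}"

definition ultrafilter :: "'a filter \<Rightarrow> bool" where
  "ultrafilter U \<longleftrightarrow> U \<noteq> bot \<and> (\<forall>P. eventually P U \<or> eventually (\<lambda>x. \<not> P x) U)"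

definition nonprincipal :: "'a filter \<Rightarrow> bool" where
  "nonprincipal U \<longleftrightarrow> (\<forall>x. U \<noteq> principal {x})"

text \<open>A set \<open>A\<close> belongs to the filter \<open>U\<close> iff \<open>eventually (\<lambda>n. n \<in> A) U\<close>.\<close>

definition Q_ultrafilter :: "nat filter \<Rightarrow> bool" where
  "Q_ultrafilter U \<longleftrightarrow> ultrafilter U \<and> nonprincipal U \<and>
     (\<forall>\<I>. partition_on UNIV \<I> \<and> (\<forall>I\<in>\<I>. \<exists>a b. I = {a..b}) \<longrightarrow>
       (\<exists>A. eventually (\<lambda>n. n \<in> A) U \<and> (\<forall>I\<in>\<I>. card (A \<inter> I) \<le> 1)))"

text \<open>\<open>2\<^sup><\<^sup>\<omega>\<close> is \<^typ>\<open>bool list\<close> ordered by \<^const>\<open>prefix\<close>. Trees must be nonempty: otherwise the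
  empty set would be a perfect tree and every ultrafilter would be Halpern--Laeuchli.\<close>

definition tree :: "bool list set \<Rightarrow> bool" where
  "tree p \<longleftrightarrow> p \<noteq> {} \<and> (\<forall>s\<in>p. \<forall>t. prefix t s \<longrightarrow> t \<in> p) \<and> (\<forall>s\<in>p. \<exists>t\<in>p. strict_prefix s t)"

definition perfect_tree :: "bool list set \<Rightarrow> bool" where
  "perfect_tree p \<longleftrightarrow> tree p \<and> (\<forall>s\<in>p. \<exists>t\<in>p. \<exists>u\<in>p. prefix s t \<and> prefix s u \<and> t \<parallel> u)"

definition restrict_levels :: "bool list set \<Rightarrow> nat set \<Rightarrow> bool list set" where
  "restrict_levels p A = {s \<in> p. length s \<in> A}"

definition Halpern_Lauchli :: "nat filter \<Rightarrow> bool" where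
  "Halpern_Lauchli U \<longleftrightarrow> ultrafilter U \<and>
     (\<forall>c :: bool list \<Rightarrow> bool. \<exists>p A. perfect_tree p \<and> eventually (\<lambda>n. n \<in> A) U \<and>
       (\<exists>i. \<forall>s \<in> restrict_levels p A. c s = i))"

lemma min_card:
  assumes "\<F> \<noteq> {}"
  shows "\<exists>X\<in>\<F>. min_card \<F> = |X|" and "\<forall>X\<in>\<F>. min_card \<F> \<le>o |X|"
proof -
  have "\<exists>r \<in> card_of ` \<F>. \<forall>r' \<in> card_of ` \<F>. r \<le>o r'"
    by (rule exists_minim_Card_order) (use assms card_of_Card_order in auto)
  then have "\<exists>r. (\<exists>X\<in>\<F>. r = |X| ) \<and> (\<forall>X\<in>\<F>. r \<le>o |X| )"
    by blast
  from someI_ex[OF this] show "\<exists>X\<in>\<F>. min_card \<F> = |X|" "\<forall>X\<in>\<F>. min_card \<F> \<le>o |X|"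
    unfolding min_card_def by blast+
qed

lemma dominating_UNIV: "dominating UNIV"
  unfolding dominating_def by blast

lemma ex_filter_base_no_pseudo_intersection:
  "\<exists>\<B>. filter_base \<B> \<and> \<not> (\<exists>P. infinite P \<and> pseudo_intersection P \<B>)"
proof -
  define X where "X k f = {x. k \<le> fst (prod_decode x) \<and> f (fst (prod_decode x)) \<le> snd (prod_decode x)}"
    for k :: nat and f :: "nat \<Rightarrow> nat"
  define \<B> where "\<B> = (\<Union>k. range (X k))"
  have inf: "infinite (X k f)" for k f
  proof
    assume "finite (X k f)"
    moreover have "range (\<lambda>n. prod_encode (k, f k + n)) \<subseteq> X k f"
      by (auto simp: X_def)
    ultimately have "finite (range (\<lambda>n. prod_encode (k, f k + n)))"
      by (rule rev_finite_subset)
    moreover have "inj (\<lambda>n. prod_encode (k, f k + n))"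
      by (auto simp: inj_def)
    ultimately show False
      using finite_imageD infinite_UNIV_nat by blast
  qed
  have "\<exists>C\<in>\<B>. C \<subseteq> A \<inter> B" if "A \<in> \<B>" "B \<in> \<B>" for A B
  proof -
    from that obtain k f l g where AB: "A = X k f" "B = X l g"
      by (auto simp: \<B>_def)
    show ?thesis
    proof
      show "X (max k l) (\<lambda>n. max (f n) (g n)) \<subseteq> A \<inter> B"
        by (auto simp: X_def AB)
      show "X (max k l) (\<lambda>n. max (f n) (g n)) \<in> \<B>"
        unfolding \<B>_def by (rule UN_I[of "max k l"]) simp_all
    qed
  qed
  moreover have "\<B> \<noteq> {}" and "\<forall>A\<in>\<B>. infinite A"
    using inf by (auto simp: \<B>_def)
  ultimately have "filter_base \<B>"
    by (simp add: filter_base_def)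
  moreover have False if P: "infinite P" "pseudo_intersection P \<B>" for P
  proof -
    have fin: "finite (P - X k f)" for k f
      using P(2) by (auto simp: pseudo_intersection_def \<B>_def)
    define C where "C m = {x \<in> P. fst (prod_decode x) = m}" for m
    have C: "finite (C m)" for m
      by (rule finite_subset[OF _ fin[of "Suc m" "\<lambda>_. 0"]]) (auto simp: C_def X_def)
    define f where "f m = Suc (Max (insert 0 ((snd \<circ> prod_decode) ` C m)))" for m
    have "snd (prod_decode x) < f (fst (prod_decode x))" if "x \<in> P" for x
      unfolding f_def less_Suc_eq_le
      by (rule Max_ge) (use C that in \<open>auto simp: C_def\<close>)
    then have "P - X 0 f = P"
      by (force simp: X_def)
    with fin[of 0 f] P(1) show False
      by simp
  qed
  ultimately show ?thesis
    by blast
qed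

lemma cardinal_p_minimal:
  shows "\<exists>\<B>. filter_base \<B> \<and> \<not> (\<exists>P. infinite P \<and> pseudo_intersection P \<B>) \<and> cardinal_p = |\<B>|"
    and "\<lbrakk>filter_base \<B>; \<not> (\<exists>P. infinite P \<and> pseudo_intersection P \<B>)\<rbrakk> \<Longrightarrow> cardinal_p \<le>o |\<B>|"
proof -
  let ?F = "{\<B>. filter_base \<B> \<and> \<not> (\<exists>P. infinite P \<and> pseudo_intersection P \<B>)}"
  have "?F \<noteq> {}"
    using ex_filter_base_no_pseudo_intersection by simp
  note m = min_card[OF this, folded cardinal_p_def]
  show "\<exists>\<B>. filter_base \<B> \<and> \<not> (\<exists>P. infinite P \<and> pseudo_intersection P \<B>) \<and> cardinal_p = |\<B>|"
    using m(1) by simp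
  show "cardinal_p \<le>o |\<B>|"
    if "filter_base \<B>" "\<not> (\<exists>P. infinite P \<and> pseudo_intersection P \<B>)"
    using m(2) that by simp
qed

lemma cardinal_d_minimal:
  shows "\<exists>\<D>. dominating \<D> \<and> cardinal_d = |\<D>|"
    and "dominating \<D> \<Longrightarrow> cardinal_d \<le>o |\<D>|"
proof -
  have "{\<D>. dominating \<D>} \<noteq> {}"
    using dominating_UNIV by blast
  note m = min_card[OF this, folded cardinal_d_def]
  show "\<exists>\<D>. dominating \<D> \<and> cardinal_d = |\<D>|"
    using m(1) by simp
  show "cardinal_d \<le>o |\<D>|" if "dominating \<D>"
    using m(2) that by simp
qed

end

theory Submission
  imports Defs "HOL-Library.Countable_Set_Type"
begin

text \<open>Colour a node \<open>s\<close> of length \<open>n\<close> by whether it extends an element of the \<open>n\<close>-th finite set of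
  nodes, in an enumeration that lists every finite set infinitely often; the levels listing the same
  set form a column. Finitely many perfect trees can be separated at some level \<open>k\<close>: a set \<open>T\<close> of nodes
  of length \<open>k\<close> contains some but not all nodes of length \<open>k\<close> of each of them. Hence the colouring is
  non-constant on each of these trees at every level \<open>n \<ge> k\<close> in the column of \<open>T\<close>. So it suffices to
  find a filter of sets meeting every column infinitely often which contains, for each \<open>g\<close> in a
  dominating family, a set \<open>X\<close> with \<open>g x < y\<close> for all \<open>x < y\<close> in \<open>X\<close>: it extends to an ultrafilter
  on whose sets the colouring is never constant along a perfect tree, and the sets \<open>X\<close> make every such
  extension a Q-ultrafilter. The filter is generated by an almost decreasing tower of length
  \<open>\<dd>\<close>, which can be continued at every stage because fewer than \<open>\<pp>\<close> sets have been chosen.\<close>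

section \<open>Ultrafilters\<close>

text \<open>Zorn's lemma gives a minimal proper filter \<open>U\<close> below \<open>F\<close>.
  Adding a set to \<open>U\<close> yields either \<open>bot\<close> or \<open>U\<close> again, which
  decides every predicate.\<close>

lemma ex_ultrafilter_le:
  fixes F :: "'a filter"
  assumes "F \<noteq> bot"
  shows "\<exists>U. ultrafilter U \<and> U \<le> F"
proof -
  let ?A = "{G. G \<noteq> bot \<and> G \<le> F}"
  let ?P = "\<lambda>G H :: 'a filter. H \<le> G"
  have "\<exists>U\<in>?A. \<forall>G\<in>?A. G \<le> U \<longrightarrow> G = U"
  proof (rule predicate_Zorn)
    show "partial_order_on ?A (relation_of ?P ?A)"
      by (auto simp: partial_order_on_def preorder_on_def refl_on_def trans_def antisym_def
          relation_of_def)
    fix C assume C: "C \<in> Chains (relation_of ?P ?A)"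
    show "\<exists>u\<in>?A. \<forall>a\<in>C. u \<le> a"
    proof (cases "C = {}")
      case True
      then show ?thesis
        using assms by auto
    next
      case False
      have sub: "C \<subseteq> ?A"
        using C by (rule Chains_relation_of)
      have lin: "G \<le> H \<or> H \<le> G" if "G \<in> C" "H \<in> C" for G H
        using C that by (auto simp: Chains_def relation_of_def)
      \<comment> \<open>Infima of nonempty chains stay proper: what holds eventually in
        \<open>Inf C\<close> already does so in some member of \<open>C\<close>.\<close>
      have "eventually (\<lambda>_. False) (Inf C) \<longleftrightarrow> (\<exists>G\<in>C. eventually (\<lambda>_. False) G)"
        by (rule eventually_Inf_base[OF False]) (use lin in \<open>metis inf.absorb1 inf.absorb2 order_refl\<close>)
      then have "Inf C \<noteq> bot"
        using sub by (auto simp flip: trivial_limit_def)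
      moreover have "Inf C \<le> F"
        using False sub by (metis (no_types, lifting) Inf_lower2 all_not_in_conv mem_Collect_eq subsetD)
      ultimately show ?thesis
        by (intro bexI[of _ "Inf C"]) (auto intro: Inf_lower)
    qed
  qed
  then obtain U where U: "U \<noteq> bot" "U \<le> F" and
    min: "\<And>G. G \<noteq> bot \<Longrightarrow> G \<le> U \<Longrightarrow> G = U"
    by (auto intro: order_trans)
  have "eventually P U \<or> eventually (\<lambda>x. \<not> P x) U" for P
  proof (cases "inf U (principal {x. P x}) = bot")
    case True
    then have "eventually (\<lambda>_. False) (inf U (principal {x. P x}))"
      by simp
    then show ?thesis
      by (simp add: eventually_inf_principal)
  next
    case False
    then have "inf U (principal {x. P x}) = U"
      by (rule min) simp
    moreover have "eventually P (inf U (principal {x. P x}))"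
      by (simp add: eventually_inf_principal)
    ultimately show ?thesis
      by simp
  qed
  with U show ?thesis
    by (auto simp: ultrafilter_def)
qed

section \<open>Pseudo-intersections of small filter bases\<close>

text \<open>Diagonalising against an enumeration shows that \<pp> is uncountable; this serves the
  countable stages of the tower.\<close>

lemma countable_filter_base_pseudo_intersection:
  assumes \<B>: "filter_base \<B>" and "countable \<B>"
  shows "\<exists>P. infinite P \<and> pseudo_intersection P \<B>"
proof -
  have ne: "\<B> \<noteq> {}" and inf: "\<And>A. A \<in> \<B> \<Longrightarrow> infinite A"
    and dir: "\<And>A B. A \<in> \<B> \<Longrightarrow> B \<in> \<B> \<Longrightarrow> \<exists>C\<in>\<B>. C \<subseteq> A \<inter> B"
    using \<B> by (auto simp: filter_base_def)
  define e where "e = from_nat_into \<B>"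
  have e: "range e = \<B>"
    unfolding e_def using ne \<open>countable \<B>\<close> by (rule range_from_nat_into)
  have "\<exists>C\<in>\<B>. C \<subseteq> (\<Inter>i\<le>n. e i)" for n
  proof (induction n)
    case 0
    show ?case
      using e by auto
  next
    case (Suc n)
    then obtain C where "C \<in> \<B>" "C \<subseteq> (\<Inter>i\<le>n. e i)"
      by blast
    moreover from dir[OF \<open>C \<in> \<B>\<close>, of "e (Suc n)"] obtain C' where "C' \<in> \<B>" "C' \<subseteq> C \<inter> e (Suc n)"
      using e by auto
    ultimately show ?case
      by (intro bexI[of _ C']) (auto simp: atMost_Suc)
  qed
  then have "infinite (\<Inter>i\<le>n. e i)" for n
    by (meson finite_subset inf)
  then have "\<forall>n. \<exists>x\<ge>n. x \<in> (\<Inter>i\<le>n. e i)"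
    by (meson infinite_nat_iff_unbounded_le)
  then obtain x where x: "\<And>n. n \<le> x n" "\<And>n i. i \<le> n \<Longrightarrow> x n \<in> e i"
    by (metis INT_D atMost_iff)
  have "infinite (range x)"
    unfolding infinite_nat_iff_unbounded_le using x(1) by blast
  moreover have "finite (range x - e i)" for i
  proof (rule finite_subset)
    show "range x - e i \<subseteq> x ` {..<i}"
    proof clarify
      fix n assume "x n \<notin> e i"
      then have "n < i"
        using x(2) by (meson not_le)
      then show "x n \<in> x ` {..<i}"
        by simp
    qed
  qed simp
  ultimately show ?thesis
    using e unfolding pseudo_intersection_def by blast
qed

lemma small_filter_base_pseudo_intersection:
  assumes "filter_base \<B>" "|\<B>| <o cardinal_p"
  shows "\<exists>P. infinite P \<and> pseudo_intersection P \<B>"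
  using assms cardinal_p_minimal(2) not_ordLess_ordLeq by blast

section \<open>Sets meeting every column infinitely often\<close>

definition col :: "nat \<Rightarrow> nat" where
  "col n = fst (prod_decode n)"

definition full :: "nat set \<Rightarrow> bool" where
  "full A \<longleftrightarrow> (\<forall>j. infinite {a \<in> A. col a = j})"

lemma full_UNIV: "full UNIV"
  unfolding full_def
proof
  fix j
  have "inj (\<lambda>n. prod_encode (j, n))"
    by (auto simp: inj_def)
  moreover have "range (\<lambda>n. prod_encode (j, n)) \<subseteq> {a \<in> UNIV. col a = j}"
    by (auto simp: col_def)
  ultimately show "infinite {a \<in> UNIV. col a = j}"
    using finite_subset range_inj_infinite by blast
qed

lemma full_unbounded:
  assumes "full A"
  shows "\<exists>a\<in>A. col a = j \<and> m \<le> a"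
  using assms unfolding full_def infinite_nat_iff_unbounded_le by blast

lemma fullI:
  assumes "\<And>j m. \<exists>a\<in>A. col a = j \<and> m \<le> a"
  shows "full A"
  using assms unfolding full_def infinite_nat_iff_unbounded_le by blast

text \<open>A pseudo-intersection is formed in the countable set of (codes of) finite subsets of
  \<open>\<omega>\<close>, so that a single application of the definition of \<open>\<pp>\<close> takes care of all columns.\<close>

lemma full_pseudo_intersection:
  assumes small: "|\<A>| <o cardinal_p" and full: "\<And>A. A \<in> \<A> \<Longrightarrow> full A"
    and chain: "\<And>A B. A \<in> \<A> \<Longrightarrow> B \<in> \<A> \<Longrightarrow> finite (A - B) \<or> finite (B - A)"
  shows "\<exists>X. full X \<and> pseudo_intersection X \<A>"
proof (cases "\<A> = {}")
  case True
  then show ?thesis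
    using full_UNIV by (auto simp: pseudo_intersection_def)
next
  case False
  \<comment> \<open>\<open>S (A, n)\<close> consists of the codes of finite subsets of
    \<open>A \<inter> {n..}\<close> that meet each column up to \<open>n\<close>. The required set
    is the union of the finite sets coded in a pseudo-intersection of these.\<close>
  define S where "S = (\<lambda>(A, n). {x. set_decode x \<subseteq> A \<inter> {n..} \<and> {..n} \<subseteq> col ` set_decode x})"
  let ?\<B> = "S ` (\<A> \<times> UNIV)"
  have less: "a < x" if "a \<in> set_decode x" for a x
  proof -
    have "2 ^ a \<le> x"
      using that by (intro leI notI) (auto simp: set_decode_def)
    then show ?thesis
      using less_exp[of a] by linarith
  qed
  have ne: "\<exists>x. x \<in> S (A, n)" if A: "A \<in> \<A>" for A n
  proof -
    have "\<forall>j. \<exists>a. a \<in> A \<and> col a = j \<and> n \<le> a"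
      using full_unbounded[OF full[OF A]] by blast
    from choice[OF this] obtain a where a: "\<And>j. a j \<in> A" "\<And>j. col (a j) = j" "\<And>j. n \<le> a j"
      by blast
    have "set_encode (a ` {..n}) \<in> S (A, n)"
      using a by (auto simp: S_def image_image)
    then show ?thesis ..
  qed
  have anti: "S (A, m) \<subseteq> S (A, n)" if "n \<le> m" for A m n
    using that by (force simp: S_def)
  have inf: "infinite (S (A, n))" if A: "A \<in> \<A>" for A n
    unfolding infinite_nat_iff_unbounded_le
  proof
    fix m
    obtain x where x: "x \<in> S (A, max n m)"
      using ne[OF A] by blast
    then obtain a where "a \<in> set_decode x" "m \<le> a"
      by (force simp: S_def)
    then have "m \<le> x"
      using less[of a x] by linarith
    with x anti[of n "max n m" A] show "\<exists>x\<ge>m. x \<in> S (A, n)"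
      by auto
  qed
  \<comment> \<open>Raising the lower bound beyond the finitely many points of \<open>A - B\<close>
    turns subsets of \<open>A\<close> into subsets of \<open>B\<close>.\<close>
  have dir: "\<exists>N. S (A, N) \<subseteq> S (A, n) \<inter> S (B, m)" if "finite (A - B)" for A B n m
  proof -
    from that obtain k where "\<forall>x\<in>A - B. x < k"
      unfolding finite_nat_set_iff_bounded ..
    then have "A \<inter> {k..} \<subseteq> B"
      by (auto simp: not_le[symmetric])
    then have "S (A, Max {k, m, n}) \<subseteq> S (A, n) \<inter> S (B, m)"
      by (auto simp: S_def subset_iff)
    then show ?thesis ..
  qed
  have base: "filter_base ?\<B>"
    unfolding filter_base_def
  proof (intro conjI ballI)
    fix X Y assume "X \<in> ?\<B>" "Y \<in> ?\<B>"
    then obtain A n B m where *: "X = S (A, n)" "Y = S (B, m)" "A \<in> \<A>" "B \<in> \<A>"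
      by auto
    show "\<exists>C\<in>?\<B>. C \<subseteq> X \<inter> Y"
      using chain[OF *(3,4)]
    proof
      assume "finite (A - B)"
      from dir[OF this] obtain N where "S (A, N) \<subseteq> S (A, n) \<inter> S (B, m)" ..
      then show ?thesis
        using * by blast
    next
      assume "finite (B - A)"
      from dir[OF this] obtain N where "S (B, N) \<subseteq> S (B, m) \<inter> S (A, n)" ..
      then show ?thesis
        using * by blast
    qed
  qed (use False inf in auto)
  \<comment> \<open>An uncountable family does not grow when paired with the naturals, so the base
    is smaller than \<pp>; otherwise the base is countable.\<close>
  have "\<exists>P. infinite P \<and> pseudo_intersection P ?\<B>"
  proof (cases "countable \<A>")
    case True
    then show ?thesis
      by (intro countable_filter_base_pseudo_intersection[OF base]) auto
  next
    case unc: False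
    then have "infinite \<A>"
      using countable_finite by blast
    moreover have "|UNIV :: nat set| \<le>o |\<A>|"
      using calculation infinite_iff_card_of_nat by blast
    ultimately have "|\<A> \<times> (UNIV :: nat set)| =o |\<A>|"
      by (intro card_of_Times_infinite_simps) auto
    then have "|?\<B>| \<le>o |\<A>|"
      using card_of_image ordLeq_ordIso_trans by blast
    then show ?thesis
      using small by (intro small_filter_base_pseudo_intersection[OF base]) (rule ordLeq_ordLess_trans)
  qed
  then obtain P where P: "infinite P" and fin: "\<And>A n. A \<in> \<A> \<Longrightarrow> finite (P - S (A, n))"
    by (force simp: pseudo_intersection_def)
  let ?X = "\<Union>(set_decode ` P)"
  have "full ?X"
  proof (rule fullI)
    fix j m
    obtain A where A: "A \<in> \<A>"
      using False by blast
    have "infinite (P \<inter> S (A, max j m))"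
      using P fin[OF A] by (metis Diff_Diff_Int Diff_infinite_finite)
    then obtain x where x: "x \<in> P" "x \<in> S (A, max j m)"
      by (metis IntE finite.emptyI all_not_in_conv)
    then have "j \<in> col ` set_decode x"
      unfolding S_def by auto
    then obtain a where a: "a \<in> set_decode x" "col a = j"
      by blast
    then have "m \<le> a"
      using x(2) unfolding S_def by auto
    with a x(1) show "\<exists>a\<in>?X. col a = j \<and> m \<le> a"
      by blast
  qed
  moreover have "finite (?X - A)" if "A \<in> \<A>" for A
  proof (rule finite_subset)
    show "?X - A \<subseteq> \<Union>(set_decode ` {x \<in> P. \<not> set_decode x \<subseteq> A})"
      by blast
    \<comment> \<open>Codes in \<open>S (A, 0)\<close> describe subsets of \<open>A\<close>, so only
      finitely many members of \<open>P\<close> contribute points outside \<open>A\<close>.\<close>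
    have "{x \<in> P. \<not> set_decode x \<subseteq> A} \<subseteq> P - S (A, 0)"
      unfolding S_def by auto
    then have "finite {x \<in> P. \<not> set_decode x \<subseteq> A}"
      using fin[OF that] finite_subset by blast
    then show "finite (\<Union>(set_decode ` {x \<in> P. \<not> set_decode x \<subseteq> A}))"
      by auto
  qed
  ultimately show ?thesis
    unfolding pseudo_intersection_def by blast
qed

text \<open>If \<open>g x\<close> bounds the right end of the interval around a point
  \<open>x\<close> of a sparse set, then no later point of the set lies in that interval.\<close>

definition sparse :: "(nat \<Rightarrow> nat) \<Rightarrow> nat set \<Rightarrow> bool" where
  "sparse g X \<longleftrightarrow> (\<forall>x\<in>X. \<forall>y\<in>X. x < y \<longrightarrow> g x < y)"

text \<open>Choose a sequence in \<open>A\<close> whose \<open>i\<close>-th term lies in column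
  \<open>col i\<close>. As \<open>col\<close> takes each value infinitely often, the range is full
  however large the gaps are.\<close>

lemma full_sparse_subset:
  assumes "full A"
  shows "\<exists>X\<subseteq>A. full X \<and> sparse g X"
proof -
  \<comment> \<open>In \<open>h (a i) < a (Suc i)\<close>, the summand \<open>n\<close> makes the
    sequence increase and the maximum puts the next term beyond \<open>g (a i)\<close>.\<close>
  define h where "h n = n + Max (g ` {..n})" for n
  have h: "n \<le> h n" "x \<le> n \<Longrightarrow> g x \<le> h n" for n x
    unfolding h_def by (simp, rule trans_le_add2, rule Max_ge) auto
  have "\<exists>a. \<forall>i. (a i \<in> A \<and> col (a i) = col i) \<and> h (a i) < a (Suc i)"
    using full_unbounded[OF assms]
    by (intro dependent_nat_choice) (metis Suc_le_eq)+
  then obtain a where a: "\<And>i. a i \<in> A" "\<And>i. col (a i) = col i" "\<And>i. h (a i) < a (Suc i)"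
    by blast
  have mono: "strict_mono a"
    unfolding strict_mono_Suc_iff using a(3) h(1) by (meson le_less_trans)
  have "full (range a)"
  proof (rule fullI)
    fix j m
    obtain i where "col i = j" "m \<le> i"
      using full_unbounded[OF full_UNIV] by blast
    then show "\<exists>x\<in>range a. col x = j \<and> m \<le> x"
      using a(2) strict_mono_imp_increasing[OF mono, of i] by auto
  qed
  moreover have "sparse g (range a)"
    unfolding sparse_def
  proof (clarify)
    fix i j assume "a i < a j"
    then have "Suc i \<le> j"
      using mono by (simp add: strict_mono_less)
    then have "a (Suc i) \<le> a j"
      using mono by (simp add: strict_mono_less_eq)
    then show "g (a i) < a j"
      using a(3)[of i] h(2)[of "a i" "a i"] by linarith
  qed
  ultimately show ?thesis
    using a(1) by blast
qed

text \<open>Recursion along the cardinal order of \<open>\<D>\<close>, whose proper initial segments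
  are smaller than \<pp>: thin out a full pseudo-intersection of the earlier sets to a sparse
  one.\<close>

lemma ex_sparse_tower:
  assumes "|\<D>| \<le>o cardinal_p"
  shows "\<exists>A. (\<forall>g. full (A g) \<and> sparse g (A g)) \<and>
    (\<forall>g\<in>\<D>. \<forall>h\<in>\<D>. finite (A g - A h) \<or> finite (A h - A g))"
proof -
  let ?r = "|\<D>|"
  have wo: "Well_order ?r"
    by (rule card_of_Well_order)
  let ?P = "\<lambda>A g X. full X \<and> sparse g X \<and> (\<forall>h. (h, g) \<in> ?r - Id \<longrightarrow> finite (X - A h))"
  have total: "(g, h) \<in> ?r - Id \<or> (h, g) \<in> ?r - Id" if "g \<in> \<D>" "h \<in> \<D>" "g \<noteq> h" for g h
    using wo that
    by (auto simp: well_order_on_def linear_order_on_def total_on_def Field_card_of)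
  have field: "g \<in> \<D> \<and> h \<in> \<D>" if "(g, h) \<in> ?r" for g h
    using that by (metis Field_card_of FieldI1 FieldI2)
  have "\<exists>A. \<forall>g. ?P A g (A g)"
  proof (rule dependent_wf_choice)
    show "wf (?r - Id)"
      using wo by (simp add: well_order_on_def)
    fix g and A :: "(nat \<Rightarrow> nat) \<Rightarrow> nat set"
    assume IH: "\<And>h. (h, g) \<in> ?r - Id \<Longrightarrow> ?P A h (A h)"
    have eq: "h \<in> underS ?r g \<longleftrightarrow> (h, g) \<in> ?r - Id" for h
      by (auto simp: underS_def)
    have "\<exists>X. full X \<and> pseudo_intersection X (A ` underS ?r g)"
    proof (cases "g \<in> \<D>")
      \<comment> \<open>A function outside \<open>\<D>\<close> has no predecessors, so any full set
        serves.\<close>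
      case False
      then have "underS ?r g = {}"
        using field eq by blast
      then show ?thesis
        using full_UNIV by (auto simp: pseudo_intersection_def)
    next
      case True
      have "|underS ?r g| <o ?r"
        using True by (intro card_of_underS[OF card_of_Card_order]) (simp add: Field_card_of)
      then have "|A ` underS ?r g| <o cardinal_p"
        using assms card_of_image ordLeq_ordLess_trans ordLess_ordLeq_trans by blast
      then show ?thesis
      proof (rule full_pseudo_intersection)
        fix X Y assume "X \<in> A ` underS ?r g" "Y \<in> A ` underS ?r g"
        then obtain h k where hk: "X = A h" "Y = A k" "(h, g) \<in> ?r - Id" "(k, g) \<in> ?r - Id"
          using eq by blast
        show "finite (X - Y) \<or> finite (Y - X)"
        proof (cases "h = k")
          case True
          then show ?thesis
            using hk by simp
        next
          case False
          then show ?thesis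
            using total[of h k] field hk IH[of h] IH[of k] by blast
        qed
      qed (use IH eq in blast)
    qed
    then obtain X where X: "full X" "pseudo_intersection X (A ` underS ?r g)"
      by blast
    obtain Y where Y: "Y \<subseteq> X" "full Y" "sparse g Y"
      using full_sparse_subset[OF X(1)] by blast
    have "finite (Y - A h)" if "(h, g) \<in> ?r - Id" for h
    proof (rule finite_subset)
      show "Y - A h \<subseteq> X - A h"
        using Y(1) by blast
      show "finite (X - A h)"
        using X(2) that eq by (auto simp: pseudo_intersection_def)
    qed
    with Y show "\<exists>Y. ?P A g Y"
      by blast
  qed auto
  then obtain A where A: "\<And>g. ?P A g (A g)"
    by blast
  show ?thesis
  proof (intro exI[of _ A] conjI allI ballI)
    fix g h assume "g \<in> \<D>" "h \<in> \<D>"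
    then show "finite (A g - A h) \<or> finite (A h - A g)"
      using A[of g] A[of h] total[of g h] by (cases "g = h") auto
  qed (use A in blast)+
qed

section \<open>Separating perfect trees\<close>

definition level :: "bool list set \<Rightarrow> nat \<Rightarrow> bool list set" where
  "level p n = {s \<in> p. length s = n}"

lemma finite_level: "finite (level p n)"
proof (rule finite_subset)
  show "level p n \<subseteq> {s. set s \<subseteq> UNIV \<and> length s = n}"
    by (auto simp: level_def)
qed (rule finite_lists_length_eq, simp)

text \<open>As there are no maximal nodes, \<open>s\<close> extends to a node of length at least
  \<open>n\<close>, which is then cut back to length \<open>n\<close>.\<close>

lemma tree_extend:
  assumes p: "tree p" and s: "s \<in> p" "length s \<le> n"
  shows "\<exists>t\<in>level p n. prefix s t"
proof -
  have "\<exists>t\<in>p. prefix s t \<and> n \<le> length t"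
  proof (induction n)
    case 0
    show ?case
      using s by auto
  next
    case (Suc n)
    then obtain t where t: "t \<in> p" "prefix s t" "n \<le> length t"
      by blast
    then obtain u where "u \<in> p" "strict_prefix t u"
      using p unfolding tree_def by blast
    then show ?case
      using t prefix_length_less[of t u]
      by (intro bexI[of _ u]) (auto simp: strict_prefix_def)
  qed
  then obtain t where t: "t \<in> p" "prefix s t" "n \<le> length t"
    by blast
  have "prefix s (take n t)"
    using t s(2) by (auto simp: prefix_def)
  moreover have "take n t \<in> p"
    using p t(1) take_is_prefix unfolding tree_def by blast
  ultimately show ?thesis
    using t(3) by (auto simp: level_def)
qed

lemma take_level:
  assumes "tree p" "m \<le> n"
  shows "take m ` level p n = level p m"
proof
  show "take m ` level p n \<subseteq> level p m"
    using assms take_is_prefix by (fastforce simp: level_def tree_def)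
  show "level p m \<subseteq> take m ` level p n"
  proof
    fix s assume s: "s \<in> level p m"
    then obtain t where "t \<in> level p n" "prefix s t"
      using tree_extend[OF assms(1), of s n] assms(2) by (auto simp: level_def)
    moreover from this s have "s = take m t"
      by (auto simp: level_def prefix_def)
    ultimately show "s \<in> take m ` level p n"
      by blast
  qed
qed

lemma card_level_mono:
  assumes "tree p" "m \<le> n"
  shows "card (level p m) \<le> card (level p n)"
  using take_level[OF assms] card_image_le[OF finite_level] by metis

text \<open>Incompatible extensions of a node at level \<open>k\<close> yield two nodes of a later
  level with the same restriction to \<open>k\<close>. So \<open>take k\<close> is not injective
  there, and the later level is strictly larger.\<close>

lemma perfect_tree_level_card:
  assumes p: "perfect_tree p"
  shows "\<exists>k. m \<le> card (level p k)"
proof (induction m)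
  case (Suc m)
  then obtain k where k: "m \<le> card (level p k)"
    by blast
  have tr: "tree p"
    using p by (simp add: perfect_tree_def)
  then obtain s0 where "s0 \<in> p"
    by (auto simp: tree_def)
  then have "[] \<in> p"
    using tr by (auto simp: tree_def)
  then obtain s where s: "s \<in> level p k"
    using tree_extend[OF tr, of "[]" k] by auto
  then obtain t u where tu: "t \<in> p" "u \<in> p" "prefix s t" "prefix s u" "t \<parallel> u"
    using p by (auto simp: perfect_tree_def level_def)
  define n where "n = max (length t) (length u)"
  obtain t' u' where tu': "t' \<in> level p n" "u' \<in> level p n" "prefix t t'" "prefix u u'"
    using tree_extend[OF tr tu(1), of n] tree_extend[OF tr tu(2), of n] by (auto simp: n_def)
  have kn: "k \<le> n"
    using s prefix_length_le[OF tu(3)] by (simp add: level_def n_def)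
  have "take k t' = s" "take k u' = s"
    using s prefix_order.trans[OF tu(3) tu'(3)] prefix_order.trans[OF tu(4) tu'(4)]
    by (auto simp: level_def prefix_def)
  moreover have "t' \<noteq> u'"
    using tu' tu(5) prefix_same_cases by blast
  ultimately have "\<not> inj_on (take k) (level p n)"
    using tu'(1,2) by (auto dest: inj_onD)
  then have "card (take k ` level p n) \<noteq> card (level p n)"
    using eq_card_imp_inj_on[OF finite_level] by blast
  then have "card (level p k) < card (level p n)"
    using take_level[OF tr kn] card_level_mono[OF tr kn] by simp
  with k show ?case
    by (intro exI[of _ n]) simp
qed simp

lemma ex_splitting_set:
  assumes "finite P" "\<And>p. p \<in> P \<Longrightarrow> 2 * card P \<le> card (L p)"
  shows "\<exists>T. \<forall>p\<in>P. L p \<inter> T \<noteq> {} \<and> L p - T \<noteq> {}"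
proof -
  have "\<exists>X Y. finite X \<and> finite Y \<and> X \<inter> Y = {} \<and> card (X \<union> Y) \<le> 2 * card P \<and>
      (\<forall>p\<in>P. L p \<inter> X \<noteq> {} \<and> L p \<inter> Y \<noteq> {})"
    \<comment> \<open>The bound \<open>N\<close> stays fixed while \<open>P\<close> varies in the
      induction.\<close>
    if "\<And>p. p \<in> P \<Longrightarrow> N \<le> card (L p)" "2 * card P \<le> N" for N
    using assms(1) that
  proof (induction P rule: finite_induct)
    case empty
    show ?case
      by (intro exI[of _ "{}"]) simp
  next
    case (insert p P)
    then obtain X Y where XY: "finite X" "finite Y" "X \<inter> Y = {}" "card (X \<union> Y) \<le> 2 * card P"
      "\<forall>p\<in>P. L p \<inter> X \<noteq> {} \<and> L p \<inter> Y \<noteq> {}"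
      by (auto)
    have "2 + card (X \<union> Y) \<le> card (L p)"
      using insert.prems(1)[of p] insert.prems(2) insert.hyps XY(4) by simp
    then have "2 \<le> card (L p - (X \<union> Y))"
      using diff_card_le_card_Diff[of "X \<union> Y" "L p"] XY(1,2) by simp
    then obtain x y where xy: "x \<in> L p - (X \<union> Y)" "y \<in> L p - (X \<union> Y)" "x \<noteq> y"
      by (meson card_2_iff' subset_iff obtain_subset_with_card_n)
    show ?case
    proof (intro exI conjI)
      show "card (insert x X \<union> insert y Y) \<le> 2 * card (insert p P)"
        using XY(1,2,4) xy insert.hyps by (simp add: card_insert_if)
    qed (use XY xy in auto)
  qed
  from this[OF assms(2) order_refl] show ?thesis
    by blast
qed

lemma perfect_trees_separated:
  assumes fin: "finite P" and perf: "\<And>p. p \<in> P \<Longrightarrow> perfect_tree p"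
  shows "\<exists>k T. \<forall>p\<in>P. level p k \<inter> T \<noteq> {} \<and> level p k - T \<noteq> {}"
proof -
  have "\<forall>p\<in>P. \<exists>k. 2 * card P \<le> card (level p k)"
    using perfect_tree_level_card[OF perf] by blast
  from bchoice[OF this] obtain k where k: "\<And>p. p \<in> P \<Longrightarrow> 2 * card P \<le> card (level p (k p))"
    by blast
  \<comment> \<open>Level sizes are monotone, so one level is large for all the trees; the inserted
    \<open>0\<close> covers empty \<open>P\<close>.\<close>
  define K where "K = Max (insert 0 (k ` P))"
  have "2 * card P \<le> card (level p K)" if "p \<in> P" for p
  proof -
    have "k p \<le> K"
      unfolding K_def using fin that by (intro Max_ge) auto
    moreover have "tree p"
      using perf[OF that] by (simp add: perfect_tree_def)
    ultimately show ?thesis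
      using k[OF that] card_level_mono le_trans by blast
  qed
  then have "\<exists>T. \<forall>p\<in>P. level p K \<inter> T \<noteq> {} \<and> level p K - T \<noteq> {}"
    by (rule ex_splitting_set[OF fin])
  then show ?thesis ..
qed

section \<open>The colouring\<close>

text \<open>Lists code the finite sets of nodes; since \<open>from_nat\<close> is surjective, every
  finite set is attached to some column.\<close>

definition colouring :: "bool list \<Rightarrow> bool" where
  "colouring s \<longleftrightarrow> (\<exists>t \<in> set (from_nat (col (length s)) :: bool list list). prefix t s)"

definition split_levels :: "bool list set \<Rightarrow> nat set" where
  "split_levels p = {n. \<exists>s\<in>level p n. \<exists>t\<in>level p n. colouring s \<and> \<not> colouring t}"

text \<open>This is what keeps the final filter proper: a full set meets the column of a separating
  set at arbitrarily high levels.\<close>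

lemma full_meets_split_levels:
  assumes fin: "finite P" and perf: "\<And>p. p \<in> P \<Longrightarrow> perfect_tree p" and "full A"
  shows "\<exists>n\<ge>m. n \<in> A \<and> (\<forall>p\<in>P. n \<in> split_levels p)"
proof -
  obtain k T where T: "\<And>p. p \<in> P \<Longrightarrow> level p k \<inter> T \<noteq> {} \<and> level p k - T \<noteq> {}"
    using perfect_trees_separated[OF fin perf] by metis
  have "finite (level UNIV k \<inter> T)"
    using finite_level by blast
  then obtain ts where ts: "set ts = level UNIV k \<inter> T"
    using finite_list by blast
  obtain n where n: "n \<in> A" "col n = to_nat ts" "max m k \<le> n"
    using full_unbounded[OF \<open>full A\<close>] by blast
  \<comment> \<open>A node of length \<open>n\<close> has a single prefix of length
    \<open>k\<close>, so its colour tells whether that prefix lies in \<open>T\<close>.\<close>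
  have colouring: "colouring s \<longleftrightarrow> t \<in> T" if "length s = n" "length t = k" "prefix t s" for s t
  proof -
    have "colouring s \<longleftrightarrow> (\<exists>t'\<in>level UNIV k \<inter> T. prefix t' s)"
      using that n by (simp add: colouring_def ts)
    also have "\<dots> \<longleftrightarrow> t \<in> T"
    proof
      assume "\<exists>t'\<in>level UNIV k \<inter> T. prefix t' s"
      then obtain t' where "t' \<in> T" "length t' = k" "prefix t' s"
        by (auto simp: level_def)
      moreover from this that have "t' = t"
        by (auto simp: prefix_def append_eq_append_conv)
      ultimately show "t \<in> T"
        by simp
    qed (use that in \<open>auto simp: level_def\<close>)
    finally show ?thesis .
  qed
  have "n \<in> split_levels p" if p: "p \<in> P" for p
  proof -
    obtain t u where tu: "t \<in> level p k" "t \<in> T" "u \<in> level p k" "u \<notin> T"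
      using T[OF p] by blast
    have tr: "tree p"
      using perf[OF p] by (simp add: perfect_tree_def)
    obtain t' u' where "t' \<in> level p n" "prefix t t'" "u' \<in> level p n" "prefix u u'"
      using tree_extend[OF tr, of t n] tree_extend[OF tr, of u n] tu n(3) by (auto simp: level_def)
    with tu show ?thesis
      using colouring[of t' t] colouring[of u' u] by (auto simp: split_levels_def level_def)
  qed
  with n show ?thesis
    by auto
qed

section \<open>The ultrafilter\<close>

text \<open>Some function in \<open>\<D>\<close> bounds the right ends of the intervals, and a set
  sparse for it picks at most one point from each. Containing all tails excludes
  principality.\<close>

lemma Q_ultrafilterI:
  assumes "ultrafilter U" "U \<le> sequentially" and dom: "dominating \<D>"
    and sp: "\<And>g. g \<in> \<D> \<Longrightarrow> \<exists>A. eventually (\<lambda>n. n \<in> A) U \<and> sparse g A"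
  shows "Q_ultrafilter U"
  unfolding Q_ultrafilter_def
proof (intro conjI allI impI)
  show "nonprincipal U"
    unfolding nonprincipal_def
  proof (intro allI notI)
    fix x assume "U = principal {x}"
    moreover have "eventually (\<lambda>n. x < n) U"
      using assms(2) eventually_gt_at_top by (rule filter_leD)
    ultimately show False
      by (simp add: eventually_principal)
  qed
  fix \<I> :: "nat set set" assume I: "partition_on UNIV \<I> \<and> (\<forall>I\<in>\<I>. \<exists>a b. I = {a..b})"
  \<comment> \<open>By disjointness the union is the one interval containing \<open>n\<close>, so
    \<open>f n\<close> is its right end.\<close>
  define f where "f n = Max (\<Union>{I \<in> \<I>. n \<in> I})" for n
  obtain g where g: "g \<in> \<D>" "\<And>n. f n \<le> g n"
    using dom unfolding dominating_def by blast
  obtain A where A: "eventually (\<lambda>n. n \<in> A) U" "sparse g A"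
    using sp[OF g(1)] by blast
  have no: "\<not> x < y" if "I \<in> \<I>" "x \<in> A \<inter> I" "y \<in> A \<inter> I" for I x y
  proof
    assume "x < y"
    have "{J \<in> \<I>. x \<in> J} = {I}"
      using I that unfolding partition_on_def disjoint_def by blast
    then have "Max I \<le> g x"
      using g(2)[of x] by (simp add: f_def)
    moreover have "finite I"
      using I that(1) by auto
    then have "y \<le> Max I"
      using that by simp
    ultimately show False
      using A(2) that \<open>x < y\<close> unfolding sparse_def by force
  qed
  have "card (A \<inter> I) \<le> 1" if "I \<in> \<I>" for I
  proof -
    have "x = y" if "x \<in> A \<inter> I" "y \<in> A \<inter> I" for x y
      using no[OF \<open>I \<in> \<I>\<close>] that by (metis nat_neq_iff)
    then show ?thesis
      by (metis card_le_Suc0_iff_eq One_nat_def card.infinite zero_le_one)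
  qed
  with A(1) show "\<exists>A. eventually (\<lambda>n. n \<in> A) U \<and> (\<forall>I\<in>\<I>. card (A \<inter> I) \<le> 1)"
    by blast
qed (fact assms)

lemma not_Halpern_LauchliI:
  assumes "\<And>p. perfect_tree p \<Longrightarrow> eventually (\<lambda>n. n \<in> split_levels p) U"
  shows "\<not> Halpern_Lauchli U"
proof
  assume HL: "Halpern_Lauchli U"
  then have "\<exists>p A. perfect_tree p \<and> eventually (\<lambda>n. n \<in> A) U \<and>
      (\<exists>i. \<forall>s \<in> restrict_levels p A. colouring s = i)"
    unfolding Halpern_Lauchli_def by simp
  then obtain p A i where p: "perfect_tree p" and A: "eventually (\<lambda>n. n \<in> A) U"
    and i: "\<forall>s \<in> restrict_levels p A. colouring s = i"
    by blast
  have "eventually (\<lambda>n. n \<in> A \<and> n \<in> split_levels p) U"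
    using A assms[OF p] by (rule eventually_conj)
  then have "eventually (\<lambda>_. False) U"
    by (rule eventually_mono)
      (use i in \<open>auto simp: split_levels_def level_def restrict_levels_def\<close>)
  then show False
    using HL by (auto simp: Halpern_Lauchli_def ultrafilter_def trivial_limit_def)
qed

theorem theorem4p16:
  assumes "cardinal_p =o cardinal_d"
  shows "\<exists>U. Q_ultrafilter U \<and> \<not> Halpern_Lauchli U"
proof -
  obtain \<D> where dom: "dominating \<D>" and "cardinal_d = |\<D>|"
    using cardinal_d_minimal(1) by blast
  then have "|\<D>| \<le>o cardinal_p"
    using assms by (metis ordIso_iff_ordLeq)
  from ex_sparse_tower[OF this] obtain A
    where full: "\<And>g. full (A g)" and sparse: "\<And>g. sparse g (A g)"
      and chain: "\<And>g h. g \<in> \<D> \<Longrightarrow> h \<in> \<D> \<Longrightarrow> finite (A g - A h) \<or> finite (A h - A g)"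
    by blast
  \<comment> \<open>Tower sets will make \<open>U\<close> a Q-ultrafilter, tails make it
    nonprincipal, and split levels keep it from being Halpern--Laeuchli.\<close>
  define S where "S = (\<lambda>(g, n, P). A g \<inter> {n..} \<inter> {k. \<forall>p\<in>P. k \<in> split_levels p})"
  let ?B = "\<D> \<times> (UNIV :: nat set) \<times> {P. finite P \<and> (\<forall>p\<in>P. perfect_tree p)}"
  define F where "F = (INF b\<in>?B. principal (S b))"
  obtain g0 where g0: "g0 \<in> \<D>"
    using dom by (auto simp: dominating_def)
  \<comment> \<open>The tail absorbs the finite error in \<open>A g \<subseteq> A h\<close>, and
    \<open>P \<union> Q\<close> keeps the conditions for both sets of trees.\<close>
  have directed: "\<exists>N. S (g, N, P \<union> Q) \<subseteq> S (g, m, P) \<inter> S (h, n, Q)"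
    if "finite (A g - A h)" for g h m n P Q
  proof -
    from that obtain k where "\<forall>x\<in>A g - A h. x < k"
      unfolding finite_nat_set_iff_bounded ..
    then have "A g \<inter> {k..} \<subseteq> A h"
      by (auto simp: not_le[symmetric])
    then have "S (g, Max {k, m, n}, P \<union> Q) \<subseteq> S (g, m, P) \<inter> S (h, n, Q)"
      by (auto simp: S_def)
    then show ?thesis ..
  qed
  \<comment> \<open>By directedness, membership in the infimum is witnessed by a single
    \<open>S b\<close>, so \<open>F\<close> is proper once every \<open>S b\<close> is
    nonempty.\<close>
  have ev: "eventually R F \<longleftrightarrow> (\<exists>b\<in>?B. eventually R (principal (S b)))" for R
    unfolding F_def
  proof (rule eventually_INF_base)
    show "?B \<noteq> {}"
      using g0 by auto
    fix a b assume "a \<in> ?B" "b \<in> ?B"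
    then obtain g m P h n Q where ab: "a = (g, m, P)" "b = (h, n, Q)" "g \<in> \<D>" "h \<in> \<D>"
      and PQ: "finite P" "finite Q" "\<forall>p\<in>P. perfect_tree p" "\<forall>p\<in>Q. perfect_tree p"
      by auto
    have B: "(g, l, P \<union> Q) \<in> ?B" "(h, l, Q \<union> P) \<in> ?B" for l
      using ab PQ by auto
    have "\<exists>x\<in>?B. S x \<subseteq> S a \<inter> S b"
      using chain[OF ab(3,4)]
    proof
      assume "finite (A g - A h)"
      then show ?thesis
        using directed[of g h P Q m n] ab(1,2) B(1) by blast
    next
      assume "finite (A h - A g)"
      from directed[OF this] obtain N where "S (h, N, Q \<union> P) \<subseteq> S (h, n, Q) \<inter> S (g, m, P)" ..
      then show ?thesis
        using ab(1,2) B(2) by blast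
    qed
    then show "\<exists>x\<in>?B. principal (S x) \<le> inf (principal (S a)) (principal (S b))"
      by simp
  qed
  have "S b \<noteq> {}" if "b \<in> ?B" for b
    using that full_meets_split_levels[OF _ _ full] by (fastforce simp: S_def)
  then have "F \<noteq> bot"
    using ev[of "\<lambda>_. False"] by (auto simp: trivial_limit_def eventually_principal)
  then obtain U where U: "ultrafilter U" "U \<le> F"
    using ex_ultrafilter_le by blast
  have mem: "eventually R U" if "(g, n, P) \<in> ?B" "\<And>k. k \<in> S (g, n, P) \<Longrightarrow> R k" for g n P R
  proof (rule filter_leD[OF U(2)])
    show "eventually R F"
      unfolding ev using that by (intro bexI[of _ "(g, n, P)"]) (auto simp: eventually_principal)
  qed
  have "Q_ultrafilter U"
  proof (rule Q_ultrafilterI[OF U(1) _ dom])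
    show "U \<le> sequentially"
      unfolding le_filter_def eventually_sequentially
    proof (intro allI impI)
      fix R :: "nat \<Rightarrow> bool" assume "\<exists>N. \<forall>n\<ge>N. R n"
      then obtain N where "\<And>n. N \<le> n \<Longrightarrow> R n"
        by blast
      then show "eventually R U"
        using g0 by (intro mem[of g0 N "{}"]) (auto simp: S_def)
    qed
    fix g assume "g \<in> \<D>"
    then show "\<exists>X. eventually (\<lambda>n. n \<in> X) U \<and> sparse g X"
      using sparse by (intro exI[of _ "A g"] conjI mem[of g 0 "{}"]) (auto simp: S_def)
  qed
  moreover have "\<not> Halpern_Lauchli U"
  proof (rule not_Halpern_LauchliI)
    fix p assume "perfect_tree p"
    then show "eventually (\<lambda>n. n \<in> split_levels p) U"
      using g0 by (intro mem[of g0 0 "{p}"]) (auto simp: S_def)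
  qed
  ultimately show ?thesis
    by blast
qed

end
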